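(* (i) There exist a function $f\in L^{\infty}(\mathbb{R})$ and a measurable set $E\subset\mathbb{R}$ of nonzero Lebesgue measure such that for every $x\in E$ one has $S_{\mathcal{I}}f(x)=\infty$ for some family $\mathcal{I}$, and hence $Sf(x)=\infty$. (ii) There exist a compactly supported function $f\in L^{\infty}(\mathbb{R})$ and a family $\mathcal{I}$ such that $S_{\mathcal{I}}f\notin BMO_d(\mathbb{R})$.
   Context: For $k\in\mathbb{Z}$, $\sigma_k$ denotes the $k$-th dyadic $\sigma$-algebra on $\mathbb{R}$, generated by the dyadic intervals $[j2^k,(j+1)2^k)$, $j\in\mathbb{Z}$, of side-length $2^k$. $\mathcal{E}_k$ is the conditional expectation with respect to $\sigma_k$, i.e. $\mathcal{E}_kf(x)$ is the average of $f$ over the dyadic interval of length $2^k$ containing $x$. For an interval $I$ of length $|I|$ write $M_{I}f=|I|^{-1}\int_{I}f(y)\,dy$. A family $\mathcal{I}=\{I_k(x)\}_{k\in\mathbb{Z},\,x\in\mathbb{R}}$ is an arbitrary choice, for every $k\in\mathbb{Z}$ and $x\in\mathbb{R}$, of an interval $I_k(x)$ of length $2^k$ containing $x$. For such a family, $$S_{\mathcal{I}}f(x)=\Big(\sum_{k\in\mathbb{Z}}|M_{I_k(x)}f-\mathcal{E}_kf(x)|^2\Big)^{1/2}\in[0,\infty].$$ Let $\mathcal{I}_k$ be the set of all intervals of length $2^k$ containing the origin, and for $I\in\mathcal{I}_k$ let $I+x=\{y+x:y\in I\}$. Define $$Sf(x)=\Big(\sum_{k\in\mathbb{Z}}\sup_{I\in\mathcal{I}_k}|M_{I+x}f-\mathcal{E}_kf(x)|^2\Big)^{1/2}\in[0,\infty].$$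 These formulas are used for any locally integrable $f$ on $\mathbb{R}$. $BMO_d(\mathbb{R})$ is the dyadic BMO space: the locally integrable functions $g$ on $\mathbb{R}$ with $$\|g\|_{BMO_d}=\sup_{I\text{ dyadic}}\frac{1}{|I|}\int_I|g-g_I|<\infty,\qquad g_I=\frac{1}{|I|}\int_I g,$$ the supremum being over all dyadic intervals $I\subset\mathbb{R}$ (of any length $2^k$, $k\in\mathbb{Z}$); equivalently $\sup_{I\text{ dyadic}}\inf_{a_I}\frac1{|I|}\int_I|g-a_I|<\infty$. *)

theory Defs
  imports "HOL-Analysis.Analysis" "HOL-Probability.Essential_Supremum"
begin

definition interval_avg :: "real set \<Rightarrow> (real \<Rightarrow> real) \<Rightarrow> real" where
  "interval_avg I f = (LINT y:I|lebesgue. f y) / measure lebesgue I"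

definition dyadic_interval :: "int \<Rightarrow> int \<Rightarrow> real set" where
  "dyadic_interval k j = {of_int j * 2 powi k ..< (of_int j + 1) * 2 powi k}"

lemma mem_dyadic_interval_iff: "x \<in> dyadic_interval k j \<longleftrightarrow> j = \<lfloor>x / 2 powi k\<rfloor>"
proof -
  have "j = \<lfloor>x / 2 powi k\<rfloor> \<longleftrightarrow> of_int j \<le> x / 2 powi k \<and> x / 2 powi k < of_int j + 1"
    using floor_eq_iff[of "x / 2 powi k" j] by auto
  then show ?thesis
    by (simp add: dyadic_interval_def pos_le_divide_eq pos_divide_less_eq)
qed

text \<open>
  The atoms of the sigma-algebra generated by the dyadic intervals of length \<open>2 powi k\<close> are these
  intervals, so the conditional expectation is the pointwise defined average below
  (for every locally integrable \<open>f\<close>, with no null-set ambiguity).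
\<close>

definition dyadic_cond_exp :: "int \<Rightarrow> (real \<Rightarrow> real) \<Rightarrow> real \<Rightarrow> real" where
  "dyadic_cond_exp k f x = interval_avg (dyadic_interval k \<lfloor>x / 2 powi k\<rfloor>) f"

text \<open>Intervals may be open, closed or half-open; boundedness is forced by the measure.\<close>

definition intervals_at :: "int \<Rightarrow> real \<Rightarrow> real set set" where
  "intervals_at k x =
     {I. is_interval I \<and> emeasure lebesgue I = ennreal (2 powi k) \<and> x \<in> I}"

definition interval_family :: "(int \<Rightarrow> real \<Rightarrow> real set) \<Rightarrow> bool" where
  "interval_family I \<longleftrightarrow> (\<forall>k x. I k x \<in> intervals_at k x)"

definition ennreal_sqrt :: "ennreal \<Rightarrow> ennreal" where
  "ennreal_sqrt t = (if t = \<infinity> then \<infinity> else ennreal (sqrt (enn2real t)))"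

definition square_fun_family ::
    "(int \<Rightarrow> real \<Rightarrow> real set) \<Rightarrow> (real \<Rightarrow> real) \<Rightarrow> real \<Rightarrow> ennreal" where
  "square_fun_family I f x =
     ennreal_sqrt (\<Sum>\<^sub>\<infinity>k\<in>UNIV. ennreal (\<bar>interval_avg (I k x) f - dyadic_cond_exp k f x\<bar>\<^sup>2))"

definition square_fun :: "(real \<Rightarrow> real) \<Rightarrow> real \<Rightarrow> ennreal" where
  "square_fun f x =
     ennreal_sqrt (\<Sum>\<^sub>\<infinity>k\<in>UNIV. SUP I\<in>intervals_at k 0.
       ennreal (\<bar>interval_avg ((\<lambda>y. y + x) ` I) f - dyadic_cond_exp k f x\<bar>\<^sup>2))"

definition Linfty :: "(real \<Rightarrow> real) set" where
  "Linfty = {f \<in> borel_measurable lebesgue. esssup lebesgue (\<lambda>x. ereal \<bar>f x\<bar>) < \<infinity>}"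

definition compactly_supported :: "(real \<Rightarrow> real) \<Rightarrow> bool" where
  "compactly_supported f \<longleftrightarrow> compact (closure {x. f x \<noteq> 0})"

definition locally_integrable :: "(real \<Rightarrow> real) \<Rightarrow> bool" where
  "locally_integrable g \<longleftrightarrow> (\<forall>K. compact K \<longrightarrow> set_integrable lebesgue K g)"

definition BMO_d_norm :: "(real \<Rightarrow> real) \<Rightarrow> ennreal" where
  "BMO_d_norm g = (SUP I \<in> range (\<lambda>(k, j). dyadic_interval k j).
     ennreal (interval_avg I (\<lambda>y. \<bar>g y - interval_avg I g\<bar>)))"

definition BMO_d :: "(real \<Rightarrow> real) set" where
  "BMO_d = {g. locally_integrable g \<and> BMO_d_norm g < \<infinity>}"

text \<open>
  A \<open>[0,\<infinity>]\<close>-valued function lies in the space of (classes of) real functions \<open>BMO_d\<close> if it agrees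
  almost everywhere with a member; in particular it is then finite almost everywhere.
\<close>

definition ext_in_BMO_d :: "(real \<Rightarrow> ennreal) \<Rightarrow> bool" where
  "ext_in_BMO_d F \<longleftrightarrow> (\<exists>g\<in>BMO_d. AE x in lebesgue. enn2ereal (F x) = ereal (g x))"

end

theory Submission
  imports Defs
begin

text \<open>
  Both parts use the indicator of an interval: at a jump of \<open>f\<close>, the dyadic interval around \<open>x\<close> and
  a suitable interval \<open>I\<^sub>k(x)\<close> of the same length can see quite different proportions of the
  two sides, and this happens with a fixed discrepancy at every scale at which \<open>x\<close> is close to the
  jump.

  For part (i) the jump is at 0, a point which is an endpoint of dyadic intervals of all lengths, and
  \<open>f\<close> is the indicator of the half-line to its right.  If \<open>0 \<le> x < 1\<close> and \<open>k \<ge> 1\<close>, the dyadic interval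
  of length \<open>2\<^sup>k\<close> around \<open>x\<close> lies entirely to the right of 0, whereas at least half of
  \<open>[x - 2\<^sup>k, x]\<close> lies to the left.  So infinitely many (large) scales contribute at least 1/4 each to
  the square function, which is therefore infinite.

  A compactly supported \<open>f\<close> excludes large scales, and by Lebesgue differentiation, at almost every
  point, only finitely many small scales can contribute more than a given constant.  They can,
  however, create an unbounded singularity: if \<open>x\<close> is at distance about \<open>2\<^sup>-\<^sup>n\<close> from the jump, about
  \<open>n\<close> scales contribute, and the square function is of size \<open>sqrt n\<close>.  A symmetric singularity of this
  growth would still be in BMO, but the family may depend on \<open>x\<close> in any way, so to the left of the
  jump it can be taken to consist of the dyadic intervals themselves, which makes the square function
  vanish there.  The result is a one-sided singularity, with mean oscillation about \<open>sqrt n\<close> on every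
  interval of length \<open>2\<^sup>-\<^sup>n\<close> that has a fixed proportion of its length on either side of the jump.
  For dyadic BMO, such intervals have to be found among the dyadic ones, so the jump is put at 1/3:
  since no power of 2 is divisible by 3, this point divides every dyadic interval of length at most 1
  that contains it in the ratio 1:2 or 2:1 (\<open>dyadic_around_third\<close>).  This both keeps the dyadic
  averages of \<open>f\<close> away from 1 and provides the two sides for the lower bound on the oscillation
  (\<open>oscillation_lower_bound\<close>).
\<close>

section \<open>Averages and sums\<close>

lemma measure_Ico [simp]: "a \<le> b \<Longrightarrow> measure lebesgue {a..<b::real} = b - a"
  by (simp add: measure_def)

lemma measure_Icc: "a \<le> b \<Longrightarrow> measure lebesgue {a..b::real} = b - a"
  by (simp add: measure_def)

lemma interval_avg_indicator:
  "interval_avg I (indicator J) = measure lebesgue (I \<inter> J) / measure lebesgue I"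
proof -
  have "(LINT y:I|lebesgue. indicator J y :: real) = (LINT y|lebesgue. indicator (I \<inter> J) y)"
    unfolding set_lebesgue_integral_def by (simp add: indicator_inter_arith)
  then show ?thesis
    by (simp add: interval_avg_def)
qed

lemma indicator_in_Linfty:
  assumes "A \<in> sets lebesgue"
  shows "(indicator A :: real \<Rightarrow> real) \<in> Linfty"
proof -
  have "esssup lebesgue (\<lambda>x. ereal \<bar>indicator A x\<bar>) \<le> 1"
    using assms by (intro esssup_I) (auto simp: indicator_def)
  also have "\<dots> < \<infinity>" by simp
  finally show ?thesis
    using assms by (simp add: Linfty_def)
qed

lemma dyadic_interval_eq:
  "dyadic_interval k j = {of_int j * 2 powi k ..< of_int j * 2 powi k + 2 powi k}"
  by (simp add: dyadic_interval_def algebra_simps)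

lemma measure_dyadic_interval [simp]: "measure lebesgue (dyadic_interval k j) = 2 powi k"
  by (simp add: dyadic_interval_eq)

lemma dyadic_interval_in_intervals_at:
  "x \<in> dyadic_interval k j \<Longrightarrow> dyadic_interval k j \<in> intervals_at k x"
  by (simp add: intervals_at_def dyadic_interval_eq)

lemma infsum_ennreal_ge_sum:
  fixes F :: "'a \<Rightarrow> ennreal"
  assumes "finite K"
  shows "sum F K \<le> (\<Sum>\<^sub>\<infinity>k. F k)"
  using assms by (simp add: nonneg_infsum_complete) (rule SUP_upper, simp)

lemma infsum_ennreal_eq_top:
  fixes F :: "'a \<Rightarrow> ennreal"
  assumes "infinite K" "c > 0" "\<And>k. k \<in> K \<Longrightarrow> c \<le> F k"
  shows "(\<Sum>\<^sub>\<infinity>k. F k) = \<infinity>"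
proof -
  have "(\<Sum>\<^sub>\<infinity>k\<in>K. F k) = \<infinity>"
    using assms by (intro infsum_superconst_infinite_ennreal[of K c F]) auto
  moreover have "(\<Sum>\<^sub>\<infinity>k\<in>K. F k) \<le> (\<Sum>\<^sub>\<infinity>k. F k)"
    by (intro infsum_mono_neutral nonneg_summable_on_complete) auto
  ultimately show ?thesis
    by (simp add: top_unique)
qed

lemma ennreal_sqrt_ge:
  assumes "0 \<le> t" "ennreal t \<le> T"
  shows "ennreal (sqrt t) \<le> ennreal_sqrt T"
proof (cases T)
  case (real r)
  then show ?thesis
    using assms by (simp add: ennreal_sqrt_def)
qed (simp add: ennreal_sqrt_def)

lemma borel_measurable_ennreal_sqrt [measurable]: "ennreal_sqrt \<in> borel_measurable borel"
  unfolding ennreal_sqrt_def by measurable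

lemma borel_measurable_infsum_ennreal:
  fixes F :: "'i::countable \<Rightarrow> 'a \<Rightarrow> ennreal"
  assumes [measurable]: "\<And>k. F k \<in> borel_measurable M"
  shows "(\<lambda>x. \<Sum>\<^sub>\<infinity>k. F k x) \<in> borel_measurable M"
proof -
  have "countable {K. finite K \<and> K \<subseteq> (UNIV :: 'i set)}"
    by (intro countable_Collect_finite_subset) simp
  then show ?thesis
    by (simp add: nonneg_infsum_complete borel_measurable_SUP)
qed

section \<open>An infinite square function\<close>

lemma heaviside_discrepancy:
  fixes x :: real and k :: int
  assumes x: "0 \<le> x" "x < 1" and k: "1 \<le> k"
  shows "1/4 \<le> \<bar>interval_avg {x - 2 powi k..x} (indicator {0..})
                - dyadic_cond_exp k (indicator {0..}) x\<bar>\<^sup>2"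
proof -
  have pow: "(2::real) \<le> 2 powi k"
    using power_int_increasing[of 1 k "2::real"] k by simp
  have "\<lfloor>x / 2 powi k\<rfloor> = 0"
    using x pow by (simp add: floor_eq_iff)
  then have *: "dyadic_interval k \<lfloor>x / 2 powi k\<rfloor> = {0..<2 powi k}"
    by (simp add: dyadic_interval_def)
  have "{0..<2 powi k} \<inter> {0..} = {0..<(2::real) powi k}"
    by auto
  then have right: "dyadic_cond_exp k (indicator {0..}) x = 1"
    by (simp add: dyadic_cond_exp_def * interval_avg_indicator)
  have "{x - 2 powi k..x} \<inter> {0..} = {0..x}"
    using x pow by auto
  then have left: "interval_avg {x - 2 powi k..x} (indicator {0..}) = x / 2 powi k"
    using x by (simp add: interval_avg_indicator measure_Icc)
  have "x / 2 powi k \<le> 1/2"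
    using x pow by (simp add: field_simps)
  then have "1/2 \<le> 1 - x / 2 powi k"
    by simp
  from power_mono[OF this, of 2] show ?thesis
    unfolding left right by (simp add: power_divide power2_commute[of 1 "x / 2 powi k"])
qed

lemma heaviside_square_fun_infinite:
  "\<exists>f\<in>Linfty. \<exists>E\<in>sets lebesgue. emeasure lebesgue E \<noteq> 0 \<and>
     (\<forall>x\<in>E. (\<exists>I. interval_family I \<and> square_fun_family I f x = \<infinity>) \<and> square_fun f x = \<infinity>)"
proof (intro bexI conjI ballI exI)
  let ?f = "indicator {0..} :: real \<Rightarrow> real"
  let ?I = "\<lambda>(k::int) x. {x - 2 powi k..x::real}"
  show "?f \<in> Linfty"
    by (rule indicator_in_Linfty) simp
  show "{0..<1::real} \<in> sets lebesgue" "emeasure lebesgue {0..<1::real} \<noteq> 0"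
    by simp_all
  show "interval_family ?I"
    by (simp add: interval_family_def intervals_at_def)
  fix x :: real
  assume "x \<in> {0..<1}"
  then have ge: "ennreal (1/4) \<le> ennreal (\<bar>interval_avg (?I k x) ?f - dyadic_cond_exp k ?f x\<bar>\<^sup>2)"
    if "k \<in> {1..}" for k
    using heaviside_discrepancy[of x k] that by (intro ennreal_leI) auto
  have inf: "infinite {1::int..}"
    by (simp add: infinite_Ici)
  show "square_fun_family ?I ?f x = \<infinity>"
    unfolding square_fun_family_def
    using infsum_ennreal_eq_top[OF inf _ ge] by (simp add: ennreal_sqrt_def)
  have "ennreal (1/4) \<le> (SUP I\<in>intervals_at k 0.
          ennreal (\<bar>interval_avg ((\<lambda>y. y + x) ` I) ?f - dyadic_cond_exp k ?f x\<bar>\<^sup>2))"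
    if "k \<in> {1..}" for k
  proof (rule SUP_upper2)
    show "{- (2 powi k)..0} \<in> intervals_at k 0"
      by (simp add: intervals_at_def)
    have "(\<lambda>y. y + x) ` {- (2 powi k)..0} = ?I k x"
      using image_add_atLeastAtMost'[of x "- (2 powi k)" 0] by (simp add: add.commute)
    then show "ennreal (1/4) \<le>
        ennreal (\<bar>interval_avg ((\<lambda>y. y + x) ` {- (2 powi k)..0}) ?f - dyadic_cond_exp k ?f x\<bar>\<^sup>2)"
      using ge[OF that] by simp
  qed
  from infsum_ennreal_eq_top[OF inf _ this] show "square_fun ?f x = \<infinity>"
    unfolding square_fun_def by (simp add: ennreal_sqrt_def)
qed

section \<open>Dyadic intervals around 1/3\<close>

abbreviation third_dyadic :: "int \<Rightarrow> real set" where
  "third_dyadic k \<equiv> dyadic_interval k \<lfloor>(1/3 :: real) / 2 powi k\<rfloor>"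

text \<open>
  With \<open>k = -n\<close>, the left endpoint is \<open>m / 2\<^sup>n\<close> where \<open>m\<close> is the integer quotient of \<open>2\<^sup>n\<close> by 3.  The
  remainder of this division is not 0, so it is 1 or 2, and \<open>2\<^sup>-\<^sup>n\<close> times one third of it is the distance
  of 1/3 from the left endpoint.
\<close>
lemma dyadic_around_third:
  fixes k :: int
  assumes "k \<le> 0"
  obtains a where "third_dyadic k = {a..<a + 2 powi k}"
    "a \<le> 1/3 - 2 powi k / 3" "1/3 + 2 powi k / 3 \<le> a + 2 powi k"
proof -
  define n where "n = nat (- k)"
  define m where "m = (2::int) ^ n div 3"
  have pow: "(2::real) powi k = 1 / 2 ^ n"
    using assms by (simp add: n_def power_int_def inverse_eq_divide power_divide)
  have "\<lfloor>(1/3) / (2::real) powi k\<rfloor> = m"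
    using floor_divide_of_int_eq[of "2 ^ n" 3, where ?'a = real] by (simp add: pow m_def)
  then have eq: "third_dyadic k = {of_int m / 2 ^ n ..< of_int m / 2 ^ n + 2 powi k}"
    by (simp add: dyadic_interval_eq pow)
  have "coprime (3::int) (2 ^ n)"
    by simp
  then have "\<not> (3::int) dvd 2 ^ n"
    using coprime_common_divisor[of 3 "2 ^ n" "3::int"] by auto
  then have "3 * m + 1 \<le> 2 ^ n" "2 ^ n + 1 \<le> 3 * (m + 1)"
    unfolding m_def by presburger+
  then have "of_int (3 * m + 1) \<le> (of_int (2 ^ n) :: real)"
    "of_int (2 ^ n + 1) \<le> (of_int (3 * (m + 1)) :: real)"
    by (simp_all only: of_int_le_iff)
  then have "(3 * of_int m + 1) / 2 ^ n \<le> (1 :: real)" "1 \<le> (3 * of_int m + 2) / (2 ^ n :: real)"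
    by (simp_all add: algebra_simps)
  then show ?thesis
    by (intro that[OF eq]) (simp_all add: pow add_divide_distrib)
qed

lemma third_dyadic_mono:
  assumes "x \<in> third_dyadic k" "k \<le> l"
  shows "x \<in> third_dyadic l"
proof -
  have eq: "\<lfloor>y / 2 powi l\<rfloor> = \<lfloor>y / 2 powi k\<rfloor> div 2 ^ nat (l - k)" for y :: real
  proof -
    have "(2::real) powi l = 2 powi k * 2 powi (l - k)"
      by (simp flip: power_int_add)
    also have "(2::real) powi (l - k) = of_int (2 ^ nat (l - k))"
      using assms by (simp add: power_int_def)
    finally have "y / 2 powi l = y / 2 powi k / of_int (2 ^ nat (l - k))"
      by simp
    then show ?thesis
      by (simp only:) (rule floor_divide_real_eq_div, simp)
  qed
  show ?thesis
    using assms(1) unfolding mem_dyadic_interval_iff eq by (simp only:)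
qed

section \<open>A square function with a one-sided singularity\<close>

text \<open>
  The right endpoint is far enough from \<open>[0, 1]\<close> that, for \<open>1/3 \<le> x < 1\<close>, all the intervals
  \<open>[x, x + 2\<^sup>k)\<close> with \<open>k \<le> 0\<close> see only the value 1, and the jump at 1/3 is the only one that matters.
\<close>
definition step_fun :: "real \<Rightarrow> real" where
  "step_fun = indicator {1/3..<2}"

text \<open>
  The scales at which the chosen interval deviates from the dyadic one.  They are restricted to those
  at which the dyadic interval around \<open>x\<close> is \<open>third_dyadic k\<close>, so that the contribution of the scale
  depends on \<open>k\<close> only.  This makes the square function computable and its measurability evident.
\<close>
definition singular_scale :: "int \<Rightarrow> real \<Rightarrow> bool" where
  "singular_scale k x \<longleftrightarrow> k \<le> 0 \<and> 1/3 \<le> x \<and> x \<in> third_dyadic k"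

definition one_sided_family :: "int \<Rightarrow> real \<Rightarrow> real set" where
  "one_sided_family k x =
     (if singular_scale k x then {x..<x + 2 powi k} else dyadic_interval k \<lfloor>x / 2 powi k\<rfloor>)"

lemma interval_family_one_sided: "interval_family one_sided_family"
  unfolding interval_family_def one_sided_family_def
  by (auto simp: mem_dyadic_interval_iff intro!: dyadic_interval_in_intervals_at)
    (simp add: intervals_at_def)

lemma step_fun_dyadic_average:
  assumes "k \<le> 0"
  shows "1/3 \<le> 1 - interval_avg (third_dyadic k) step_fun"
proof -
  obtain a where a: "third_dyadic k = {a..<a + 2 powi k}"
    "a \<le> 1/3 - 2 powi k / 3" "1/3 + 2 powi k / 3 \<le> a + 2 powi k"
    using dyadic_around_third[OF assms] .
  have pow: "0 < (2::real) powi k" "(2::real) powi k \<le> 1"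
    using power_int_increasing[of k 0 "2::real"] assms by simp_all
  have "{a..<a + 2 powi k} \<inter> {1/3..<2} = {1/3..<a + 2 powi k}"
    using a pow by auto
  then have avg: "interval_avg (third_dyadic k) step_fun = (a + 2 powi k - 1/3) / 2 powi k"
    using a pow unfolding a(1) by (simp add: step_fun_def interval_avg_indicator)
  show ?thesis
    unfolding avg using a(2) pow by (simp add: field_simps)
qed

lemma step_fun_discrepancy:
  "interval_avg (one_sided_family k x) step_fun - dyadic_cond_exp k step_fun x =
     (if singular_scale k x then 1 - interval_avg (third_dyadic k) step_fun else 0)"
proof (cases "singular_scale k x")
  case True
  then have k: "k \<le> 0" and x: "1/3 \<le> x" "x \<in> third_dyadic k"
    by (auto simp: singular_scale_def)
  then have "\<lfloor>x / 2 powi k\<rfloor> = \<lfloor>(1/3 :: real) / 2 powi k\<rfloor>"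
    by (simp add: mem_dyadic_interval_iff)
  then have exp: "dyadic_cond_exp k step_fun x = interval_avg (third_dyadic k) step_fun"
    by (simp add: dyadic_cond_exp_def)
  obtain a where "third_dyadic k = {a..<a + 2 powi k}" "a \<le> 1/3 - 2 powi k / 3"
    using dyadic_around_third[OF k] .
  moreover have "(2::real) powi k \<le> 1" "0 < (2::real) powi k"
    using power_int_increasing[of k 0 "2::real"] k by simp_all
  ultimately have "{x..<x + 2 powi k} \<inter> {1/3..<2} = {x..<x + 2 powi k}"
    using x by auto
  then have "interval_avg {x..<x + 2 powi k} step_fun = 1"
    by (simp add: step_fun_def interval_avg_indicator)
  with True exp show ?thesis
    by (simp add: one_sided_family_def)
next
  case False
  then show ?thesis
    by (simp add: one_sided_family_def dyadic_cond_exp_def)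
qed

lemma one_sided_square_fun_eq_0:
  assumes "x < 1/3"
  shows "square_fun_family one_sided_family step_fun x = 0"
  using assms
  by (simp add: square_fun_family_def step_fun_discrepancy singular_scale_def ennreal_sqrt_def)

text \<open>
  The point \<open>x\<close> lies in \<open>third_dyadic k\<close> for each of the \<open>n + 1\<close> scales \<open>-n \<le> k \<le> 0\<close>, and each contributes
  at least 1/9.
\<close>
lemma one_sided_square_fun_ge:
  assumes "1/3 \<le> x" "x \<in> third_dyadic (- int n)"
  shows "ennreal (sqrt (Suc n) / 3) \<le> square_fun_family one_sided_family step_fun x"
proof -
  let ?F = "\<lambda>k. ennreal (\<bar>interval_avg (one_sided_family k x) step_fun
                          - dyadic_cond_exp k step_fun x\<bar>\<^sup>2)"
  have ge: "ennreal (1/9) \<le> ?F k" if "k \<in> {- int n..0}" for k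
  proof -
    have "singular_scale k x"
      using that assms third_dyadic_mono[OF assms(2), of k] by (simp add: singular_scale_def)
    moreover have "1/3 \<le> 1 - interval_avg (third_dyadic k) step_fun"
      using that by (intro step_fun_dyadic_average) simp
    from power_mono[OF this, of 2]
    have "1/9 \<le> (1 - interval_avg (third_dyadic k) step_fun)\<^sup>2"
      by (simp add: power_divide)
    ultimately show ?thesis
      by (intro ennreal_leI) (simp add: step_fun_discrepancy)
  qed
  have "ennreal (Suc n / 9) = (\<Sum>k\<in>{- int n..0}. ennreal (1/9))"
    by (subst sum_ennreal) (simp_all add: add.commute)
  also have "\<dots> \<le> sum ?F {- int n..0}"
    using ge by (rule sum_mono)
  also have "\<dots> \<le> (\<Sum>\<^sub>\<infinity>k. ?F k)"
    by (rule infsum_ennreal_ge_sum) simp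
  finally have "ennreal (sqrt (Suc n / 9)) \<le> square_fun_family one_sided_family step_fun x"
    unfolding square_fun_family_def by (intro ennreal_sqrt_ge) simp_all
  then show ?thesis
    by (simp add: real_sqrt_divide)
qed

lemma one_sided_square_fun_measurable:
  "square_fun_family one_sided_family step_fun \<in> borel_measurable lebesgue"
proof -
  have [measurable]: "Measurable.pred lebesgue (singular_scale k)" for k
  proof -
    have "{x. singular_scale k x} = (if k \<le> 0 then {1/3..} \<inter> third_dyadic k else {})"
      by (auto simp: singular_scale_def)
    also have "\<dots> \<in> sets lebesgue"
      by (simp add: dyadic_interval_eq)
    finally show ?thesis
      by (simp add: pred_def)
  qed
  have [measurable]: "(\<lambda>x. \<Sum>\<^sub>\<infinity>k. ennreal (\<bar>interval_avg (one_sided_family k x) step_fun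
      - dyadic_cond_exp k step_fun x\<bar>\<^sup>2)) \<in> borel_measurable lebesgue"
    unfolding step_fun_discrepancy by (rule borel_measurable_infsum_ennreal) measurable
  show ?thesis
    unfolding square_fun_family_def by measurable
qed

section \<open>Failure of dyadic BMO\<close>

text \<open>
  On the part \<open>L\<close> the deviation from \<open>m\<close> is \<open>\<bar>m\<bar>\<close>, and on the part \<open>R\<close> it is at least \<open>s - \<bar>m\<bar>\<close>.  As the two parts
  have the same measure, \<open>m\<close> cancels.
\<close>
lemma oscillation_lower_bound:
  fixes g :: "real \<Rightarrow> real"
  assumes g: "set_integrable lebesgue D g" and D: "D \<in> lmeasurable"
    and LR: "L \<in> lmeasurable" "R \<in> lmeasurable" "L \<subseteq> D" "R \<subseteq> D" "L \<inter> R = {}"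
    and r: "measure lebesgue L = r" "measure lebesgue R = r"
    and gL: "AE x in lebesgue. x \<in> L \<longrightarrow> g x = 0"
    and gR: "AE x in lebesgue. x \<in> R \<longrightarrow> s \<le> g x"
  shows "s * r \<le> (LINT x:D|lebesgue. \<bar>g x - m\<bar>)"
proof -
  have int: "set_integrable lebesgue D (\<lambda>x. \<bar>g x - m\<bar>)"
    using D by (intro set_integrable_abs set_integral_diff g)
      (simp add: set_integrable_def lmeasurable_iff_integrable)
  have intL: "integrable lebesgue (\<lambda>x. \<bar>m\<bar> * indicator L x)"
    and intR: "integrable lebesgue (\<lambda>x. (s - \<bar>m\<bar>) * indicator R x)"
    using LR by (auto simp: fmeasurable_def)
  have "s * r = (LINT x|lebesgue. \<bar>m\<bar> * indicator L x + (s - \<bar>m\<bar>) * indicator R x)"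
    by (simp only: Bochner_Integration.integral_add[OF intL intR] integral_mult_right_zero
        integral_indicator) (simp add: r algebra_simps)
  also have "\<dots> \<le> (LINT x|lebesgue. indicator D x *\<^sub>R \<bar>g x - m\<bar>)"
  proof (rule integral_mono_AE)
    show "integrable lebesgue (\<lambda>x. indicator D x *\<^sub>R \<bar>g x - m\<bar>)"
      using int by (simp add: set_integrable_def)
    show "AE x in lebesgue. \<bar>m\<bar> * indicator L x + (s - \<bar>m\<bar>) * indicator R x
            \<le> indicator D x *\<^sub>R \<bar>g x - m\<bar>"
      using gL gR by eventually_elim (use LR in \<open>auto simp: indicator_def\<close>)
  qed (use intL intR in auto)
  finally show ?thesis
    by (simp add: set_lebesgue_integral_def)
qed

lemma one_sided_square_fun_not_BMO_d:
  "\<not> ext_in_BMO_d (square_fun_family one_sided_family step_fun)"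
proof
  let ?S = "square_fun_family one_sided_family step_fun"
  assume "ext_in_BMO_d ?S"
  then obtain g where g: "locally_integrable g" "BMO_d_norm g < \<infinity>"
    and ae: "AE x in lebesgue. enn2ereal (?S x) = ereal (g x)"
    by (auto simp: ext_in_BMO_d_def BMO_d_def)
  from g(2) obtain B where B: "0 \<le> B" "BMO_d_norm g = ennreal B"
    by (cases "BMO_d_norm g") auto
  have bound: "sqrt (Suc n) / 9 \<le> B" for n
  proof -
    define k where "k = - int n"
    define \<delta> :: real where "\<delta> = 2 powi k"
    define D where "D = third_dyadic k"
    define m where "m = interval_avg D g"
    have \<delta>: "\<delta> > 0"
      by (simp add: \<delta>_def)
    have "k \<le> 0"
      by (simp add: k_def)
    then obtain a where a: "D = {a..<a + \<delta>}" "a \<le> 1/3 - \<delta> / 3" "1/3 + \<delta> / 3 \<le> a + \<delta>"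
      unfolding D_def \<delta>_def by (rule dyadic_around_third)
    have "set_integrable lebesgue {a..a + \<delta>} g"
      using g(1) by (simp add: locally_integrable_def)
    then have "set_integrable lebesgue D g"
      by (rule set_integrable_subset) (auto simp: a)
    moreover have "AE x in lebesgue. x \<in> {1/3 - \<delta> / 3..<1/3} \<longrightarrow> g x = 0"
      using ae
    proof eventually_elim
      case (elim x)
      then show ?case
        using one_sided_square_fun_eq_0[of x] by (auto simp: zero_ennreal.rep_eq)
    qed
    moreover have "AE x in lebesgue. x \<in> {1/3..<1/3 + \<delta> / 3} \<longrightarrow> sqrt (Suc n) / 3 \<le> g x"
      using ae
    proof eventually_elim
      case (elim x)
      show ?case
      proof
        assume x: "x \<in> {1/3..<1/3 + \<delta> / 3}"
        then have "x \<in> D"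
          using a \<delta> by auto
        then have "ennreal (sqrt (Suc n) / 3) \<le> ?S x"
          using x by (intro one_sided_square_fun_ge) (auto simp: D_def k_def)
        then have "enn2ereal (ennreal (sqrt (Suc n) / 3)) \<le> ereal (g x)"
          unfolding less_eq_ennreal.rep_eq elim .
        then show "sqrt (Suc n) / 3 \<le> g x"
          by simp
      qed
    qed
    ultimately have "sqrt (Suc n) / 3 * (\<delta> / 3) \<le> (LINT x:D|lebesgue. \<bar>g x - m\<bar>)"
      using a \<delta> by (intro oscillation_lower_bound[where L = "{1/3 - \<delta> / 3..<1/3}"
            and R = "{1/3..<1/3 + \<delta> / 3}"]) (auto simp: fmeasurable_def)
    then have "sqrt (Suc n) / 9 \<le> interval_avg D (\<lambda>x. \<bar>g x - m\<bar>)"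
      using \<delta> by (simp add: interval_avg_def a field_simps)
    moreover have "ennreal (interval_avg D (\<lambda>x. \<bar>g x - m\<bar>)) \<le> ennreal B"
      unfolding B(2)[symmetric] BMO_d_norm_def m_def
      by (rule SUP_upper) (auto simp: D_def)
    then have "interval_avg D (\<lambda>x. \<bar>g x - m\<bar>) \<le> B"
      using B(1) by (simp add: ennreal_le_iff)
    ultimately show ?thesis
      by linarith
  qed
  obtain n :: nat where "(9 * B)\<^sup>2 < n"
    using reals_Archimedean2 by blast
  then have "9 * B < sqrt (Suc n)"
    by (intro real_less_rsqrt) simp
  with bound[of n] show False
    by simp
qed

theorem theorem1p1:
  shows "(\<exists>f\<in>Linfty. \<exists>E\<in>sets lebesgue. emeasure lebesgue E \<noteq> 0 \<and>
            (\<forall>x\<in>E. (\<exists>I. interval_family I \<and> square_fun_family I f x = \<infinity>) \<and>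
                     square_fun f x = \<infinity>))
       \<and> (\<exists>f\<in>Linfty. compactly_supported f \<and>
            (\<exists>I. interval_family I \<and>
                 square_fun_family I f \<in> borel_measurable lebesgue \<and>
                 \<not> ext_in_BMO_d (square_fun_family I f)))"
proof (intro conjI heaviside_square_fun_infinite)
  have "step_fun \<in> Linfty"
    unfolding step_fun_def by (rule indicator_in_Linfty) simp
  moreover have "{x. step_fun x \<noteq> 0} = {1/3..<2}"
    by (auto simp: step_fun_def indicator_def)
  then have "compactly_supported step_fun"
    by (simp add: compactly_supported_def)
  ultimately show "\<exists>f\<in>Linfty. compactly_supported f \<and>
      (\<exists>I. interval_family I \<and> square_fun_family I f \<in> borel_measurable lebesgue \<and>
           \<not> ext_in_BMO_d (square_fun_family I f))"
    using interval_family_one_sided one_sided_square_fun_measurable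
      one_sided_square_fun_not_BMO_d by blast
qed

end
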